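(* For the convergence exponent $\tau$ defined in the context, $\dim_{\rm H}\{x\in[0,1):\tau(x)=\alpha\}=1/2$ for every $\alpha\in[0,\infty)$, and $\dim_{\rm H}\{x\in[0,1):\tau(x)=\infty\}=1$.
   Context: For $x\in[0,1)$ let $x=[a_1(x),a_2(x),\dots]$ be its continued fraction expansion (infinite iff $x$ is irrational), with positive integer partial quotients $a_n(x)$. Define $\tau(x):=\inf\{s\ge0:\sum_{n\ge1}a_n(x)^{-s}<\infty\}\in[0,\infty]$ (so $\tau(x)=0$ for rational $x$). $\dim_{\rm H}$ denotes Hausdorff dimension. *)

theory Defs
  imports "HOL-Analysis.Analysis"
begin

section \<open>Hausdorff measure and dimension\<close>

text \<open>The empty set contributes \<open>0\<close> even for \<open>s = 0\<close> (so countable covers include finite ones),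
  whereas a nonempty set contributes \<open>1\<close> for \<open>s = 0\<close>; this is spelled out because
  \<open>0 powr 0 = 0\<close> in HOL.\<close>

definition diam_pow :: "real \<Rightarrow> 'a::metric_space set \<Rightarrow> ennreal" where
  "diam_pow s U = (if U = {} then 0 else if s = 0 then 1 else ennreal (diameter U powr s))"

text \<open>Boundedness has to be required separately, as \<open>diameter\<close> is unspecified on
  unbounded sets.\<close>

definition delta_cover :: "real \<Rightarrow> 'a::metric_space set \<Rightarrow> (nat \<Rightarrow> 'a set) \<Rightarrow> bool" where
  "delta_cover \<delta> E U \<longleftrightarrow>
     E \<subseteq> (\<Union>n. U n) \<and> (\<forall>n. bounded (U n) \<and> diameter (U n) \<le> \<delta>)"

definition hausdorff_premeasure :: "real \<Rightarrow> real \<Rightarrow> 'a::metric_space set \<Rightarrow> ennreal" where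
  "hausdorff_premeasure s \<delta> E = (INF U\<in>{U. delta_cover \<delta> E U}. \<Sum>n. diam_pow s (U n))"

definition hausdorff_measure :: "real \<Rightarrow> 'a::metric_space set \<Rightarrow> ennreal" where
  "hausdorff_measure s E = (SUP \<delta>\<in>{0<..}. hausdorff_premeasure s \<delta> E)"

definition hausdorff_dim :: "'a::metric_space set \<Rightarrow> ereal" where
  "hausdorff_dim E = Inf {ereal s | s. 0 \<le> s \<and> hausdorff_measure s E = 0}"


section \<open>Continued fractions\<close>

definition gauss_map :: "real \<Rightarrow> real" where
  "gauss_map x = (if x = 0 then 0 else frac (1 / x))"

text \<open>For \<open>x\<close> in \<open>[0,1)\<close>, the partial quotient \<open>a\<^sub>k(x)\<close>, \<open>k \<ge> 1\<close>, is \<open>cf_digit x (k - 1)\<close>;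
  it exists iff \<open>k - 1\<close> lies in \<open>cf_index x\<close>. The expansion stops as soon as an iterate
  of the Gauss map vanishes, and values of \<open>cf_digit x\<close> outside \<open>cf_index x\<close> are meaningless.\<close>

definition cf_index :: "real \<Rightarrow> nat set" where
  "cf_index x = {n. (gauss_map ^^ n) x \<noteq> 0}"

definition cf_digit :: "real \<Rightarrow> nat \<Rightarrow> nat" where
  "cf_digit x n = nat \<lfloor>1 / (gauss_map ^^ n) x\<rfloor>"

lemma gauss_map_iterate_bounds:
  assumes "x \<in> {0..<1}"
  shows "(gauss_map ^^ n) x \<in> {0..<1}"
  using assms by (cases n) (auto simp: gauss_map_def frac_lt_1)

lemma cf_digit_step:
  assumes "x \<in> {0..<1}" "n \<in> cf_index x"
  shows "1 \<le> cf_digit x n"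
    and "(gauss_map ^^ n) x = 1 / (real (cf_digit x n) + (gauss_map ^^ Suc n) x)"
proof -
  define y where "y = (gauss_map ^^ n) x"
  have y: "0 < y" "y < 1"
    using gauss_map_iterate_bounds[OF assms(1), of n] assms(2)
    by (auto simp: y_def cf_index_def)
  then have f: "1 \<le> \<lfloor>1 / y\<rfloor>"
    by (simp add: le_floor_iff)
  then show "1 \<le> cf_digit x n"
    unfolding cf_digit_def y_def[symmetric] by linarith
  have "real (cf_digit x n) + (gauss_map ^^ Suc n) x = 1 / y"
    using f y by (simp add: cf_digit_def gauss_map_def frac_def flip: y_def)
  then show "(gauss_map ^^ n) x = 1 / (real (cf_digit x n) + (gauss_map ^^ Suc n) x)"
    by (simp add: y_def)
qed

definition convergence_exponent :: "real \<Rightarrow> ereal" where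
  "convergence_exponent x =
     Inf {ereal s | s. 0 \<le> s \<and>
       summable (\<lambda>n. if n \<in> cf_index x then real (cf_digit x n) powr (- s) else 0)}"

end

theory Submission
  imports Defs
begin

text \<open>If \<open>\<tau>(x) < \<infinity>\<close>, then \<open>x\<close> is rational or its partial quotients tend to infinity, so for each
  \<open>M\<close> some iterate of the Gauss map takes \<open>x\<close> to \<open>0\<close> or into the set of points all of whose partial
  quotients are at least \<open>M\<close>. The latter is covered by its images under \<open>x \<mapsto> 1/(a + x)\<close>, \<open>a \<ge> M\<close>,
  which contract by \<open>a\<^sup>-\<^sup>2\<close>; for \<open>s > 1/2\<close> and large \<open>M\<close> the sum of the \<open>a\<^sup>-\<^sup>2\<^sup>s\<close> is less than \<open>1\<close>, so the
  set is \<open>s\<close>-null. Hence \<open>\<tau> < \<infinity>\<close> has dimension at most \<open>1/2\<close>, and its complement in \<open>[0,1)\<close> has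
  dimension \<open>1\<close>.

  For the lower bound choose \<open>s\<^sub>n \<rightarrow> \<infinity>\<close> with bounded ratios and convergence exponent \<open>\<alpha>\<close> (about
  \<open>n\<close> to the power \<open>1/\<alpha>\<close>, or \<open>2\<^sup>n\<close> if \<open>\<alpha> = 0\<close>). Every \<open>x\<close> with \<open>s\<^sub>n \<le> a\<^sub>n(x) < 2s\<^sub>n\<close> has \<open>\<tau>(x) = \<alpha>\<close>, and
  reading the offsets \<open>a\<^sub>n(x) - s\<^sub>n\<close> as mixed radix digits maps these \<open>x\<close> onto \<open>[0,1)\<close> in a way that is
  Hoelder continuous of every exponent below \<open>1/2\<close>.\<close>

section \<open>Hausdorff measures\<close>

lemma hausdorff_premeasure_le:
  assumes "delta_cover \<delta> E U"
  shows "hausdorff_premeasure s \<delta> E \<le> (\<Sum>n. diam_pow s (U n))"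
  unfolding hausdorff_premeasure_def using assms by (auto intro: INF_lower)

lemma hausdorff_premeasure_obtain_cover:
  assumes "hausdorff_premeasure s \<delta> E < c"
  obtains U where "delta_cover \<delta> E U" "(\<Sum>n. diam_pow s (U n)) < c"
  using assms unfolding hausdorff_premeasure_def by (auto simp: INF_less_iff)

lemma hausdorff_premeasure_mono:
  assumes "E \<subseteq> F" "\<delta>' \<le> \<delta>"
  shows "hausdorff_premeasure s \<delta> E \<le> hausdorff_premeasure s \<delta>' F"
proof -
  have "delta_cover \<delta> E U" if "delta_cover \<delta>' F U" for U
    using that assms order_trans unfolding delta_cover_def by blast
  then show ?thesis
    unfolding hausdorff_premeasure_def by (intro INF_superset_mono) auto
qed

text \<open>Each \<open>A i\<close> gets a cover whose sum exceeds the infimum by less than e /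
  2^(i+1). All these covering sets are listed in one sequence through the coding of pairs, so the
  excesses add up to at most e.\<close>

lemma hausdorff_premeasure_UN:
  "hausdorff_premeasure s \<delta> (\<Union>i::nat. A i) \<le> (\<Sum>i. hausdorff_premeasure s \<delta> (A i))"
    (is "?L \<le> ?R")
proof (rule ennreal_le_epsilon)
  fix e :: real assume fin: "?R < top" and e: "0 < e"
  define d where "d i = ennreal (e * (1/2) ^ Suc i)" for i
  have "\<exists>U. delta_cover \<delta> (A i) U
            \<and> (\<Sum>n. diam_pow s (U n)) < hausdorff_premeasure s \<delta> (A i) + d i" for i
  proof -
    have "hausdorff_premeasure s \<delta> (A i) < hausdorff_premeasure s \<delta> (A i) + d i"
      using e fin by (auto simp: less_top d_def dest!: ennreal_suminf_lessD)
    then show ?thesis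
      using hausdorff_premeasure_obtain_cover by metis
  qed
  then obtain U where U: "\<And>i. delta_cover \<delta> (A i) (U i)"
    "\<And>i. (\<Sum>n. diam_pow s (U i n)) < hausdorff_premeasure s \<delta> (A i) + d i"
    by metis
  define V where "V k = (case prod_decode k of (i, n) \<Rightarrow> U i n)" for k
  have "delta_cover \<delta> (\<Union>i. A i) V"
    unfolding delta_cover_def
  proof (intro conjI allI)
    show "(\<Union>i. A i) \<subseteq> (\<Union>k. V k)"
    proof
      fix x assume "x \<in> (\<Union>i. A i)"
      then obtain i n where "x \<in> U i n"
        using U(1) unfolding delta_cover_def by blast
      then have "x \<in> V (prod_encode (i, n))"
        by (simp add: V_def)
      then show "x \<in> (\<Union>k. V k)" by blast
    qed
  qed (use U(1) in \<open>auto simp: V_def delta_cover_def split: prod.split\<close>)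
  then have "?L \<le> (\<Sum>k. diam_pow s (V k))"
    by (rule hausdorff_premeasure_le)
  also have "\<dots> = (\<Sum>k. (\<lambda>(i, n). diam_pow s (U i n)) (prod_decode k))"
    by (auto simp: V_def intro!: arg_cong[where f = suminf] split: prod.split)
  also have "\<dots> = (\<Sum>i. \<Sum>n. diam_pow s (U i n))"
    by (rule suminf_ennreal_2dimen) simp
  also have "\<dots> \<le> (\<Sum>i. hausdorff_premeasure s \<delta> (A i) + d i)"
    using U(2) by (intro suminf_le) (auto intro: less_imp_le)
  also have "\<dots> = ?R + (\<Sum>i. d i)"
    by (subst suminf_add[symmetric]) auto
  also have "(\<Sum>i. d i) = ennreal e"
    unfolding d_def using e power_half_series
    by (subst suminf_ennreal2) (auto simp: sums_iff suminf_mult simp del: power_Suc intro!: summable_mult)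
  finally show "?L \<le> ?R + ennreal e" .
qed

section \<open>Behaviour under Lipschitz maps\<close>

lemma bounded_lipschitz_image:
  assumes L: "L-lipschitz_on U f" and "bounded U"
  shows "bounded (f ` U)"
proof (cases "U = {}")
  case False
  then obtain x where x: "x \<in> U" by blast
  obtain e where e: "\<And>y. y \<in> U \<Longrightarrow> dist x y \<le> e"
    using \<open>bounded U\<close> bounded_any_center by metis
  have "dist (f x) (f y) \<le> L * e" if "y \<in> U" for y
    using lipschitz_onD[OF L x that] mult_left_mono[OF e[OF that] lipschitz_on_nonneg[OF L]]
    by linarith
  then show ?thesis by (auto simp: bounded_def)
qed simp

lemma diameter_lipschitz_image_le:
  assumes "L-lipschitz_on U f" "bounded U"
  shows "diameter (f ` U) \<le> L * diameter U"
proof (cases "U = {}")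
  case False
  have "dist (f x) (f y) \<le> L * diameter U" if "x \<in> U" "y \<in> U" for x y
    using lipschitz_onD[OF assms(1) that] diameter_bounded_bound[OF assms(2) that]
      lipschitz_on_nonneg[OF assms(1)] by (meson mult_left_mono order_trans)
  with False show ?thesis
    by (auto simp: diameter_def intro!: cSUP_least)
qed simp

lemma hausdorff_premeasure_lipschitz_image_le:
  assumes L: "L-lipschitz_on E f" and s: "0 < s" and fin: "hausdorff_premeasure s \<delta> E < top"
  shows "hausdorff_premeasure s (L * \<delta>) (f ` E) \<le> ennreal (L powr s) * hausdorff_premeasure s \<delta> E"
proof -
  have L0: "0 \<le> L" using L by (rule lipschitz_on_nonneg)
  have *: "hausdorff_premeasure s (L * \<delta>) (f ` E) \<le> ennreal (L powr s) * (\<Sum>n. diam_pow s (U n))"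
    if U: "delta_cover \<delta> E U" for U
  proof -
    have bd: "bounded (U n)" "diameter (U n) \<le> \<delta>" for n
      using U by (auto simp: delta_cover_def)
    have lip: "L-lipschitz_on (U n \<inter> E) f" "bounded (U n \<inter> E)" for n
      using bd by (auto intro: lipschitz_on_subset[OF L] bounded_subset)
    have diam: "diameter (f ` (U n \<inter> E)) \<le> L * diameter (U n)" for n
      using diameter_lipschitz_image_le[OF lip] diameter_subset[of "U n \<inter> E" "U n"] bd L0
      by (meson Int_lower1 mult_left_mono order_trans)
    have bdi: "bounded (f ` (U n \<inter> E))" for n
      by (rule bounded_lipschitz_image[OF lip])
    \<comment> \<open>The covering sets are cut down to \<open>E\<close> before \<open>f\<close> is
      applied, because \<open>f\<close> is Lipschitz only there.\<close>
    have "delta_cover (L * \<delta>) (f ` E) (\<lambda>n. f ` (U n \<inter> E))"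
      unfolding delta_cover_def
    proof (intro conjI allI)
      show "f ` E \<subseteq> (\<Union>n. f ` (U n \<inter> E))"
        using U unfolding delta_cover_def by blast
      show "diameter (f ` (U n \<inter> E)) \<le> L * \<delta>" for n
        using diam[of n] bd(2)[of n] L0 by (meson mult_left_mono order_trans)
    qed (rule bdi)
    then have "hausdorff_premeasure s (L * \<delta>) (f ` E) \<le> (\<Sum>n. diam_pow s (f ` (U n \<inter> E)))"
      by (rule hausdorff_premeasure_le)
    also have "\<dots> \<le> (\<Sum>n. ennreal (L powr s) * diam_pow s (U n))"
    proof (intro suminf_le)
      show "diam_pow s (f ` (U n \<inter> E)) \<le> ennreal (L powr s) * diam_pow s (U n)" for n
        using s L0 diam[of n] diameter_ge_0[OF bdi[of n]] diameter_ge_0[OF bd(1)[of n]]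
        by (auto simp: diam_pow_def ennreal_mult[symmetric] powr_mult[symmetric]
            intro!: ennreal_leI powr_mono2)
    qed auto
    finally show ?thesis by simp
  qed
  \<comment> \<open>The factor \<open>c\<close> is carried past the infimum by division, which
    excludes \<open>c = 0\<close>. In that case one cover is enough, and finiteness of the
    premeasure supplies it.\<close>
  define c where "c = ennreal (L powr s)"
  show ?thesis
  proof (cases "c = 0")
    case True
    obtain U where "delta_cover \<delta> E U"
      using hausdorff_premeasure_obtain_cover[OF fin] by blast
    from *[OF this] True show ?thesis by (simp add: c_def)
  next
    case False
    then have c: "0 < c" "c \<noteq> top" by (auto simp: c_def zero_less_iff_neq_zero)
    have "hausdorff_premeasure s (L * \<delta>) (f ` E) / c \<le> hausdorff_premeasure s \<delta> E"
      unfolding hausdorff_premeasure_def[of s \<delta>]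
      using * c by (intro INF_greatest divide_le_posI_ennreal) (auto simp: c_def mult.commute)
    then have "c * (hausdorff_premeasure s (L * \<delta>) (f ` E) / c) \<le> c * hausdorff_premeasure s \<delta> E"
      by (rule mult_left_mono) simp
    with c False show ?thesis
      by (simp add: c_def[symmetric] ennreal_times_divide mult_divide_eq_ennreal mult.commute[of c])
  qed
qed

section \<open>Null sets\<close>

lemma hausdorff_measure_eq_0_iff:
  "hausdorff_measure s E = 0 \<longleftrightarrow> (\<forall>\<delta>>0. hausdorff_premeasure s \<delta> E = 0)"
  by (auto simp: hausdorff_measure_def bot_ennreal[symmetric] SUP_bot_conv)

lemma hausdorff_measure_null_mono:
  assumes "hausdorff_measure s F = 0" "E \<subseteq> F"
  shows "hausdorff_measure s E = 0"
  using assms hausdorff_premeasure_mono[OF assms(2) order_refl, of s]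
  unfolding hausdorff_measure_eq_0_iff by (metis le_zero_eq)

lemma hausdorff_measure_null_UN:
  assumes "\<And>i::nat. hausdorff_measure s (A i) = 0"
  shows "hausdorff_measure s (\<Union>i. A i) = 0"
  unfolding hausdorff_measure_eq_0_iff
proof (intro allI impI)
  fix \<delta> :: real assume "0 < \<delta>"
  then have "hausdorff_premeasure s \<delta> (A i) = 0" for i
    using assms hausdorff_measure_eq_0_iff by blast
  then show "hausdorff_premeasure s \<delta> (\<Union>i. A i) = 0"
    using hausdorff_premeasure_UN[of s \<delta> A] by simp
qed

lemma hausdorff_measure_null_Un:
  assumes "hausdorff_measure s A = 0" "hausdorff_measure s B = 0"
  shows "hausdorff_measure s (A \<union> B) = 0"
proof -
  have "hausdorff_measure s (\<Union>i::nat. if i = 0 then A else B) = 0"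
    using assms by (intro hausdorff_measure_null_UN) simp
  then show ?thesis
    by (rule hausdorff_measure_null_mono) (auto split: if_splits intro: exI[of _ "1::nat"])
qed

lemma hausdorff_measure_null_singleton:
  assumes "0 < s"
  shows "hausdorff_measure s {x} = 0"
  unfolding hausdorff_measure_eq_0_iff
proof (intro allI impI)
  fix \<delta> :: real assume "0 < \<delta>"
  then have "delta_cover \<delta> {x} (\<lambda>_. {x})"
    by (auto simp: delta_cover_def)
  from hausdorff_premeasure_le[OF this, of s] assms
  show "hausdorff_premeasure s \<delta> {x} = 0"
    by (simp add: diam_pow_def)
qed

lemma hausdorff_measure_null_lipschitz_image:
  assumes L: "L-lipschitz_on E f" and s: "0 < s" and null: "hausdorff_measure s E = 0"
  shows "hausdorff_measure s (f ` E) = 0"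
  unfolding hausdorff_measure_eq_0_iff
proof (intro allI impI)
  fix \<delta> :: real assume "0 < \<delta>"
  \<comment> \<open>Enlarging the constant to \<open>L + 1\<close> makes it positive, so that the
    scale \<delta> can be divided by it.\<close>
  have L': "(L + 1)-lipschitz_on E f" and L0: "0 \<le> L"
    using lipschitz_on_le[OF L, of "L + 1"] lipschitz_on_nonneg[OF L] by auto
  have "hausdorff_premeasure s (\<delta> / (L + 1)) E = 0"
    using null L0 \<open>0 < \<delta>\<close> unfolding hausdorff_measure_eq_0_iff by simp
  then show "hausdorff_premeasure s \<delta> (f ` E) = 0"
    using hausdorff_premeasure_lipschitz_image_le[OF L' s, of "\<delta> / (L + 1)"] L0 by simp
qed

text \<open>For sets of diameter at most 1 a larger exponent gives a smaller power. Capping the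
  scale at 1 is harmless, since premeasures only grow as the scale shrinks.\<close>

lemma hausdorff_measure_null_exponent_mono:
  assumes null: "hausdorff_measure s E = 0" and "0 \<le> s" "s \<le> t"
  shows "hausdorff_measure t E = 0"
  unfolding hausdorff_measure_eq_0_iff
proof (intro allI impI)
  fix \<delta> :: real assume "0 < \<delta>"
  define \<eta> where "\<eta> = min \<delta> 1"
  have "diam_pow t U \<le> diam_pow s U" if "bounded U" "diameter U \<le> 1" for U :: "'a set"
    using that assms(2,3) diameter_ge_0[OF that(1)]
    by (auto simp: diam_pow_def powr_le_one_le intro!: ennreal_leI powr_mono' powr_le1)
  then have "hausdorff_premeasure t \<eta> E \<le> (\<Sum>n. diam_pow s (U n))" if "delta_cover \<eta> E U" for U
    using that by (intro order_trans[OF hausdorff_premeasure_le[OF that]] suminf_le)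
      (auto simp: \<eta>_def delta_cover_def)
  then have "hausdorff_premeasure t \<eta> E \<le> hausdorff_premeasure s \<eta> E"
    unfolding hausdorff_premeasure_def[of s] by (intro INF_greatest) auto
  also have "\<dots> = 0"
    using null \<open>0 < \<delta>\<close> unfolding hausdorff_measure_eq_0_iff \<eta>_def by simp
  finally show "hausdorff_premeasure t \<delta> E = 0"
    using hausdorff_premeasure_mono[of E E \<eta> \<delta> t] by (simp add: \<eta>_def)
qed

text \<open>Substituting a cover into itself shrinks the diameters by the factor \<open>c\<close> and the sums by \<open>r\<close>.\<close>

lemma hausdorff_measure_null_self_cover:
  fixes f :: "nat \<Rightarrow> 'a::metric_space \<Rightarrow> 'a"
  assumes s: "0 < s" and bd: "bounded E" and cover: "E \<subseteq> (\<Union>i. f i ` E)"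
    and lip: "\<And>i. (L i)-lipschitz_on E (f i)" and c: "\<And>i. L i \<le> c" "c < 1"
    and sum: "(\<Sum>i. ennreal (L i powr s)) \<le> ennreal r" and r: "0 \<le> r" "r < 1"
  shows "hausdorff_measure s E = 0"
proof -
  define D where "D = diameter E + 1"
  have D: "0 < D" "diameter E \<le> D"
    using diameter_ge_0[OF bd] by (auto simp: D_def)
  have c0: "0 \<le> c"
    using lipschitz_on_nonneg[OF lip[of 0]] c(1)[of 0] by linarith
  have bound: "hausdorff_premeasure s (c ^ n * D) E \<le> ennreal (r ^ n * D powr s)" for n
  proof (induction n)
    case 0
    define U where "U i = (if i = 0 then E else {})" for i :: nat
    have "delta_cover D E U"
      using bd D by (auto simp: delta_cover_def U_def)
    then have "hausdorff_premeasure s D E \<le> (\<Sum>i. diam_pow s (U i))"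
      by (rule hausdorff_premeasure_le)
    also have "\<dots> = (\<Sum>i\<in>{0}. diam_pow s (U i))"
      by (rule suminf_finite) (auto simp: U_def diam_pow_def)
    also have "\<dots> \<le> ennreal (D powr s)"
      using s D diameter_ge_0[OF bd] by (auto simp: U_def diam_pow_def intro!: ennreal_leI powr_mono2)
    finally show ?case by simp
  next
    case (Suc n)
    then have fin: "hausdorff_premeasure s (c ^ n * D) E < top"
      using le_less_trans by fastforce
    have "hausdorff_premeasure s (c ^ Suc n * D) E
        \<le> hausdorff_premeasure s (c ^ Suc n * D) (\<Union>i. f i ` E)"
      by (rule hausdorff_premeasure_mono[OF cover order_refl])
    also have "\<dots> \<le> (\<Sum>i. hausdorff_premeasure s (c ^ Suc n * D) (f i ` E))"
      by (rule hausdorff_premeasure_UN)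
    also have "\<dots> \<le> (\<Sum>i. hausdorff_premeasure s (L i * (c ^ n * D)) (f i ` E))"
      using c0 D c(1)
      by (intro suminf_le hausdorff_premeasure_mono) (auto intro!: mult_right_mono simp: mult.assoc)
    also have "\<dots> \<le> (\<Sum>i. ennreal (L i powr s) * hausdorff_premeasure s (c ^ n * D) E)"
      by (intro suminf_le hausdorff_premeasure_lipschitz_image_le lip s fin) auto
    also have "\<dots> = (\<Sum>i. ennreal (L i powr s)) * hausdorff_premeasure s (c ^ n * D) E"
      by simp
    also have "\<dots> \<le> ennreal r * ennreal (r ^ n * D powr s)"
      by (intro mult_mono sum Suc) auto
    also have "\<dots> = ennreal (r ^ Suc n * D powr s)"
      using r by (simp add: ennreal_mult[symmetric] mult.assoc)
    finally show ?case .
  qed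
  show ?thesis
    unfolding hausdorff_measure_eq_0_iff
  proof (intro allI impI)
    fix \<delta> :: real assume "0 < \<delta>"
    have "(\<lambda>n. c ^ n * D) \<longlonglongrightarrow> 0 * D"
      using c0 c(2) by (intro tendsto_intros LIMSEQ_power_zero) auto
    then have "eventually (\<lambda>n. c ^ n * D < \<delta>) sequentially"
      using \<open>0 < \<delta>\<close> order_tendstoD(2) by fastforce
    then have "eventually (\<lambda>n. hausdorff_premeasure s \<delta> E \<le> ennreal (r ^ n * D powr s)) sequentially"
      by eventually_elim (rule order_trans[OF hausdorff_premeasure_mono bound], auto)
    moreover have "(\<lambda>n. ennreal (r ^ n * D powr s)) \<longlonglongrightarrow> ennreal (0 * D powr s)"
      using r by (intro tendsto_intros LIMSEQ_power_zero) auto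
    ultimately have "hausdorff_premeasure s \<delta> E \<le> ennreal (0 * D powr s)"
      by (intro tendsto_lowerbound[of _ _ sequentially]) auto
    then show "hausdorff_premeasure s \<delta> E = 0" by simp
  qed
qed

section \<open>Self-similarity and mass distribution on the unit interval\<close>

lemma hausdorff_measure_unit_interval_null:
  assumes "1 < s"
  shows "hausdorff_measure s {0..<1::real} = 0"
proof (rule hausdorff_measure_null_self_cover)
  \<comment> \<open>The interval consists of two copies of itself scaled by 1/2, and 2 * (1/2)^s < 1
    for s > 1. The remaining maps are constant with Lipschitz constant 0, so they add nothing to the
    sum.\<close>
  define f :: "nat \<Rightarrow> real \<Rightarrow> real"
    where "f i x = (if i = 0 then x / 2 else if i = 1 then (x + 1) / 2 else 0)" for i x
  define L :: "nat \<Rightarrow> real" where "L i = (if i < 2 then 1/2 else 0)" for i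
  show "{0..<1} \<subseteq> (\<Union>i. f i ` {0..<1})"
  proof
    fix x :: real assume x: "x \<in> {0..<1}"
    then have "x = f 0 (2 * x) \<and> 2 * x \<in> {0..<1} \<or> x = f 1 (2 * x - 1) \<and> 2 * x - 1 \<in> {0..<1}"
      by (auto simp: f_def)
    then show "x \<in> (\<Union>i. f i ` {0..<1})" by blast
  qed
  show "(L i)-lipschitz_on {0..<1} (f i)" for i
    by (rule lipschitz_onI) (auto simp: L_def f_def dist_real_def less_2_cases_iff abs_if field_simps)
  show "L i \<le> 1/2" for i by (simp add: L_def)
  have "(\<Sum>i. ennreal (L i powr s)) = (\<Sum>i\<in>{0,1}. ennreal (L i powr s))"
    using assms by (intro suminf_finite) (auto simp: L_def)
  also have "\<dots> = ennreal (2 * (1/2) powr s)"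
    by (simp add: L_def ennreal_plus[symmetric] del: ennreal_plus)
  finally show "(\<Sum>i. ennreal (L i powr s)) \<le> ennreal (2 * (1/2) powr s)" by simp
  have "(1/2::real) powr s < (1/2) powr 1"
    using assms by (intro powr_less_mono') auto
  then show "2 * (1/2::real) powr s < 1" by simp
qed (use assms in auto)

text \<open>The mass distribution principle, in the form where the mass is transported from Lebesgue
  measure by a map whose inverse is Hoelder continuous.\<close>

lemma hausdorff_measure_holder_inverse_image_nonzero:
  fixes g :: "real \<Rightarrow> 'a::metric_space"
  assumes s: "0 \<le> s" and C: "0 < C"
    and holder: "\<And>t t'. t \<in> {0..<1} \<Longrightarrow> t' \<in> {0..<1} \<Longrightarrow> \<bar>t - t'\<bar> \<le> C * dist (g t) (g t') powr s"
  shows "hausdorff_measure s (g ` {0..<1}) \<noteq> 0"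
proof
  assume "hausdorff_measure s (g ` {0..<1}) = 0"
  \<comment> \<open>The bound 1 / (2C) is chosen so that the intervals constructed below would cover
    [0,1) with total length less than 1.\<close>
  then have "hausdorff_premeasure s 1 (g ` {0..<1}) < ennreal (1 / (2 * C))"
    unfolding hausdorff_measure_eq_0_iff using C by simp
  then obtain U where U: "delta_cover 1 (g ` {0..<1}) U"
    and small: "(\<Sum>n. diam_pow s (U n)) < ennreal (1 / (2 * C))"
    by (rule hausdorff_premeasure_obtain_cover)
  define W where "W n = {t \<in> {0..<1}. g t \<in> U n}" for n
  have bd: "bounded (U n)" for n using U by (simp add: delta_cover_def)
  \<comment> \<open>This is the value of \<open>diam_pow\<close> on a nonempty set; the case s = 0
    is separate because 0 powr 0 = 0.\<close>
  define e where "e n = (if s = 0 then 1 else diameter (U n) powr s)" for n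
  \<comment> \<open>The preimage \<open>W n\<close> need not be measurable. By the Hoelder bound it
    lies in a ball of radius \<open>C * e n\<close> about any of its points, whose length is at most
    \<open>2 * C * e n\<close>.\<close>
  define B where "B n = (if W n = {} then {} else cball (SOME t. t \<in> W n) (C * e n))" for n
  have e0: "0 \<le> e n" for n by (simp add: e_def)
  have sub: "W n \<subseteq> B n" for n
  proof
    fix t assume t: "t \<in> W n"
    define t0 where "t0 = (SOME t. t \<in> W n)"
    have t0: "t0 \<in> W n" using t unfolding t0_def by (rule someI)
    have "dist (g t0) (g t) powr s \<le> e n"
      using t t0 diameter_bounded_bound[OF bd[of n], of "g t0" "g t"] s
      by (auto simp: W_def e_def intro!: powr_mono2)
    then have "\<bar>t0 - t\<bar> \<le> C * e n"
      using holder[of t0 t] t t0 C by (auto simp: W_def intro: order_trans)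
    then show "t \<in> B n"
      using t by (auto simp: B_def t0_def[symmetric] dist_real_def)
  qed
  have emB: "emeasure lborel (B n) \<le> ennreal (2 * C) * diam_pow s (U n)" for n
  proof (cases "W n = {}")
    case False
    then have "U n \<noteq> {}" by (auto simp: W_def)
    then have "diam_pow s (U n) = ennreal (e n)" by (auto simp: diam_pow_def e_def)
    with False show ?thesis
      using C e0[of n] by (simp add: B_def cball_eq_atLeastAtMost ennreal_mult[symmetric] mult.assoc)
  qed (simp add: B_def)
  have "{0..<1} \<subseteq> (\<Union>n. B n)"
  proof
    fix t :: real assume t: "t \<in> {0..<1}"
    then obtain n where "g t \<in> U n"
      using U unfolding delta_cover_def by blast
    with t have "t \<in> W n" by (simp add: W_def)
    then show "t \<in> (\<Union>n. B n)" using sub by blast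
  qed
  then have "emeasure lborel {0..<1::real} \<le> emeasure lborel (\<Union>n. B n)"
    by (intro emeasure_mono) (auto simp: B_def)
  also have "\<dots> \<le> (\<Sum>n. emeasure lborel (B n))"
    by (intro emeasure_subadditive_countably) (auto simp: B_def)
  also have "\<dots> \<le> (\<Sum>n. ennreal (2 * C) * diam_pow s (U n))"
    by (intro suminf_le emB) auto
  also have "\<dots> = ennreal (2 * C) * (\<Sum>n. diam_pow s (U n))" by simp
  also have "\<dots> < ennreal (2 * C) * ennreal (1 / (2 * C))"
    using C small by (intro ennreal_mult_strict_left_mono) auto
  also have "\<dots> = 1" using C by (simp add: ennreal_mult[symmetric])
  finally show False by simp
qed

lemma hausdorff_measure_unit_interval_nonzero:
  assumes "0 \<le> s" "s \<le> 1"
  shows "hausdorff_measure s {0..<1::real} \<noteq> 0"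
proof -
  \<comment> \<open>Distances in [0,1) are below 1, so lowering the exponent from 1 to
    \<open>s\<close> can only increase the power: the identity serves as the transport map.\<close>
  have "\<bar>t - t'\<bar> \<le> 1 * dist (id t) (id t') powr s" if "t \<in> {0..<1}" "t' \<in> {0..<1}" for t t' :: real
    using that assms powr_mono'[of s 1 "\<bar>t - t'\<bar>"] by (auto simp: dist_real_def)
  from hausdorff_measure_holder_inverse_image_nonzero[OF assms(1) _ this] show ?thesis by simp
qed

section \<open>Bounds on the dimension from null and non-null exponents\<close>

lemma hausdorff_dim_le:
  assumes "0 \<le> d" "\<And>s. d < s \<Longrightarrow> hausdorff_measure s E = 0"
  shows "hausdorff_dim E \<le> ereal d"
proof (rule ereal_le_epsilon2)
  fix e :: real assume "0 < e"
  then have "hausdorff_dim E \<le> ereal (d + e)"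
    unfolding hausdorff_dim_def using assms by (intro Inf_lower) auto
  then show "hausdorff_dim E \<le> ereal d + ereal e" by simp
qed

lemma hausdorff_dim_ge:
  assumes "\<And>s. 0 \<le> s \<Longrightarrow> s < d \<Longrightarrow> hausdorff_measure s E \<noteq> 0"
  shows "ereal d \<le> hausdorff_dim E"
  unfolding hausdorff_dim_def using assms by (intro Inf_greatest) (force simp: not_le[symmetric])

section \<open>Continued fractions with large digits\<close>

text \<open>The inverse branch of the Gauss map that prepends the partial quotient
  \<open>a\<close>.\<close>

definition cf_branch :: "nat \<Rightarrow> real \<Rightarrow> real" where
  "cf_branch a x = 1 / (real a + x)"

lemma cf_branch_diff:
  assumes "0 < real a + x" "0 < real a + y"
  shows "\<bar>cf_branch a x - cf_branch a y\<bar> = \<bar>x - y\<bar> / ((real a + x) * (real a + y))"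
proof -
  have "cf_branch a x - cf_branch a y = (y - x) / ((real a + x) * (real a + y))"
    using assms by (simp add: cf_branch_def field_simps)
  with assms show ?thesis by (simp add: abs_minus_commute abs_mult)
qed

lemma cf_branch_diff_le:
  assumes "0 < a" "0 \<le> x" "0 \<le> y"
  shows "\<bar>cf_branch a x - cf_branch a y\<bar> \<le> \<bar>x - y\<bar> / (real a)\<^sup>2"
  using assms by (subst cf_branch_diff) (auto simp: power2_eq_square intro!: divide_left_mono mult_mono)

lemma cf_branch_lipschitz:
  assumes "0 < a" "E \<subseteq> {0..<1}"
  shows "(1 / (real a)\<^sup>2)-lipschitz_on E (cf_branch a)"
  using assms cf_branch_diff_le[OF assms(1)]
  by (intro lipschitz_onI) (auto simp: dist_real_def subset_iff)

lemma gauss_map_in_unit: "gauss_map x \<in> {0..<1}"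
  by (auto simp: gauss_map_def frac_lt_1)

lemma cf_branch_gauss_map:
  assumes "x \<in> {0..<1}" "x \<noteq> 0"
  shows "x = cf_branch (cf_digit x 0) (gauss_map x)" "1 \<le> cf_digit x 0"
  using cf_digit_step[OF assms(1), of 0] assms(2) by (auto simp: cf_index_def cf_branch_def)

lemma cf_digit_funpow: "cf_digit ((gauss_map ^^ N) x) n = cf_digit x (n + N)"
  by (simp add: cf_digit_def funpow_add)

lemma cf_index_funpow: "n \<in> cf_index ((gauss_map ^^ N) x) \<longleftrightarrow> n + N \<in> cf_index x"
  by (simp add: cf_index_def funpow_add)

text \<open>Requiring every index to be present leaves out the points whose expansion terminates;
  those are handled through the orbit reaching 0.\<close>

definition cf_large :: "nat \<Rightarrow> real set" where
  "cf_large M = {x \<in> {0..<1}. \<forall>n. n \<in> cf_index x \<and> M \<le> cf_digit x n}"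

text \<open>The set is mapped into itself by the Gauss map, and a point is recovered from its image
  by the branch of its first partial quotient, which is at least \<open>M\<close>.\<close>

lemma cf_large_self_cover: "cf_large M \<subseteq> (\<Union>i. cf_branch (M + i) ` cf_large M)"
proof
  fix x assume x: "x \<in> cf_large M"
  then have x': "x \<in> {0..<1}" "x \<noteq> 0" "M \<le> cf_digit x 0"
    by (auto simp: cf_large_def cf_index_def dest: spec[of _ 0])
  have "gauss_map x \<in> cf_large M"
    using x gauss_map_in_unit cf_digit_funpow[of 1 x] cf_index_funpow[of _ 1 x]
    by (simp add: cf_large_def)
  moreover have "x = cf_branch (M + (cf_digit x 0 - M)) (gauss_map x)"
    using cf_branch_gauss_map(1)[OF x'(1,2)] x'(3) by simp
  ultimately show "x \<in> (\<Union>i. cf_branch (M + i) ` cf_large M)" by blast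
qed

lemma cf_large_null:
  assumes "1/2 < s"
  obtains M where "hausdorff_measure s (cf_large M) = 0"
proof -
  define h where "h n = real n powr (- (2 * s))" for n
  have summable: "summable h"
    unfolding h_def using assms by (subst summable_real_powr_iff) auto
  from suminf_exist_split[OF _ this, of "1/2"] obtain N
    where N: "\<And>n. N \<le> n \<Longrightarrow> norm (\<Sum>i. h (i + n)) < 1/2" by auto
  \<comment> \<open>At least \<open>N\<close>, so that the tail sum is below 1/2; at least 2, so
    that all contraction ratios are bounded by 1/4.\<close>
  define M where "M = N + 2"
  have "hausdorff_measure s (cf_large M) = 0"
  proof (rule hausdorff_measure_null_self_cover[OF _ _ cf_large_self_cover])
    show "bounded (cf_large M)"
      by (rule bounded_subset[of "{0..1}"]) (auto simp: cf_large_def)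
    show "(1 / (real (M + i))\<^sup>2)-lipschitz_on (cf_large M) (cf_branch (M + i))" for i
      by (rule cf_branch_lipschitz) (auto simp: M_def cf_large_def)
    show "1 / (real (M + i))\<^sup>2 \<le> 1/4" for i
    proof -
      have "1 / (real (M + i))\<^sup>2 \<le> 1 / 2\<^sup>2"
        by (intro divide_left_mono power_mono) (auto simp: M_def)
      then show ?thesis by simp
    qed
    have "(1 / (real (M + i))\<^sup>2) powr s = h (i + M)" for i
      by (simp add: h_def M_def powr_minus_divide powr_powr[symmetric] powr_divide add_ac)
    then have "(\<Sum>i. ennreal ((1 / (real (M + i))\<^sup>2) powr s)) = (\<Sum>i. ennreal (h (i + M)))"
      by simp
    also have "\<dots> = ennreal (\<Sum>i. h (i + M))"
      by (intro suminf_ennreal2 summable_ignore_initial_segment summable) (simp add: h_def)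
    also have "\<dots> \<le> ennreal (1/2)"
      using N[of M] by (intro ennreal_leI) (simp add: M_def)
    finally show "(\<Sum>i. ennreal ((1 / (real (M + i))\<^sup>2) powr s)) \<le> ennreal (1/2)" .
  qed (use assms in auto)
  with that show thesis .
qed

text \<open>Apart from the point 0, the preimage is contained in a countable union of branch images
  of \<open>A\<close>, and each branch is Lipschitz.\<close>

lemma gauss_map_vimage_null:
  assumes s: "0 < s" and A: "A \<subseteq> {0..<1}" and null: "hausdorff_measure s A = 0"
  shows "hausdorff_measure s {x \<in> {0..<1}. gauss_map x \<in> A} = 0"
proof -
  have "{x \<in> {0..<1}. gauss_map x \<in> A} \<subseteq> {0} \<union> (\<Union>i. cf_branch (Suc i) ` A)"
  proof
    fix x assume x: "x \<in> {x \<in> {0..<1}. gauss_map x \<in> A}"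
    show "x \<in> {0} \<union> (\<Union>i. cf_branch (Suc i) ` A)"
    proof (cases "x = 0")
      case False
      with x cf_branch_gauss_map[of x]
      have "x = cf_branch (Suc (cf_digit x 0 - 1)) (gauss_map x)" by simp
      with x show ?thesis by blast
    qed simp
  qed
  moreover have "hausdorff_measure s ({0} \<union> (\<Union>i. cf_branch (Suc i) ` A)) = 0"
    by (intro hausdorff_measure_null_Un hausdorff_measure_null_singleton hausdorff_measure_null_UN
        hausdorff_measure_null_lipschitz_image[OF cf_branch_lipschitz] s null A) simp
  ultimately show ?thesis using hausdorff_measure_null_mono by blast
qed

lemma gauss_map_funpow_vimage_null:
  assumes s: "0 < s" and A: "A \<subseteq> {0..<1}" and null: "hausdorff_measure s A = 0"
  shows "hausdorff_measure s {x \<in> {0..<1}. (gauss_map ^^ N) x \<in> A} = 0"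
proof (induction N)
  case 0
  show ?case by (rule hausdorff_measure_null_mono[OF null]) auto
next
  case (Suc N)
  have "hausdorff_measure s
      {x \<in> {0..<1}. gauss_map x \<in> {x \<in> {0..<1}. (gauss_map ^^ N) x \<in> A}} = 0"
    by (rule gauss_map_vimage_null[OF s _ Suc]) auto
  then show ?case
    by (rule hausdorff_measure_null_mono) (use gauss_map_in_unit in \<open>auto simp: funpow_swap1\<close>)
qed

section \<open>Points of finite convergence exponent\<close>

lemma convergence_exponent_finite_eventually_large:
  assumes x: "x \<in> {0..<1}" and fin: "convergence_exponent x \<noteq> \<infinity>"
  shows "\<exists>N. (gauss_map ^^ N) x \<in> insert 0 (cf_large M)"
proof (cases "\<exists>N. (gauss_map ^^ N) x = 0")
  case False
  then have idx: "n \<in> cf_index x" for n by (auto simp: cf_index_def)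
  \<comment> \<open>The infimum of the empty set is infinity, so a finite exponent yields some
    \<open>s\<close> for which the series converges.\<close>
  have "{ereal s | s. 0 \<le> s \<and>
       summable (\<lambda>n. if n \<in> cf_index x then real (cf_digit x n) powr (- s) else 0)} \<noteq> {}"
    using fin unfolding convergence_exponent_def by (metis Inf_empty top_ereal_def)
  then obtain s where s: "0 \<le> s" and "summable (\<lambda>n. real (cf_digit x n) powr (- s))"
    using idx by auto
  then have "(\<lambda>n. real (cf_digit x n) powr (- s)) \<longlonglongrightarrow> 0"
    using summable_LIMSEQ_zero by blast
  \<comment> \<open>The comparison value uses \<open>Suc M\<close> so that it is positive even for M
    = 0. A digit below \<open>M\<close> would make the term at least this large.\<close>
  then have "eventually (\<lambda>n. real (cf_digit x n) powr (- s) < real (Suc M) powr (- s)) sequentially"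
    by (rule order_tendstoD) simp
  then obtain N where N: "\<And>n. N \<le> n \<Longrightarrow> real (cf_digit x n) powr (- s) < real (Suc M) powr (- s)"
    by (auto simp: eventually_sequentially)
  have "M \<le> cf_digit x n" if "N \<le> n" for n
  proof (rule ccontr)
    assume "\<not> M \<le> cf_digit x n"
    then have "real (Suc M) powr (- s) \<le> real (cf_digit x n) powr (- s)"
      using cf_digit_step(1)[OF x idx[of n]] s by (intro powr_mono2') auto
    with N[OF that] show False by simp
  qed
  then have "(gauss_map ^^ N) x \<in> cf_large M"
    using gauss_map_iterate_bounds[OF x, of N] idx
    by (simp add: cf_large_def cf_digit_funpow cf_index_funpow)
  then show ?thesis by blast
qed auto

lemma convergence_exponent_finite_null:
  assumes "1/2 < s"
  shows "hausdorff_measure s {x \<in> {0..<1}. convergence_exponent x \<noteq> \<infinity>} = 0"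
proof -
  obtain M where M: "hausdorff_measure s (cf_large M) = 0"
    using cf_large_null[OF assms] .
  define A where "A = insert 0 (cf_large M)"
  have A: "A \<subseteq> {0..<1}" by (auto simp: A_def cf_large_def)
  have "hausdorff_measure s ({0} \<union> cf_large M) = 0"
    using assms by (intro hausdorff_measure_null_Un hausdorff_measure_null_singleton M) simp
  then have "hausdorff_measure s A = 0" by (simp add: A_def)
  then have "hausdorff_measure s (\<Union>N. {x \<in> {0..<1}. (gauss_map ^^ N) x \<in> A}) = 0"
    using assms A by (intro hausdorff_measure_null_UN gauss_map_funpow_vimage_null) auto
  then show ?thesis
    by (rule hausdorff_measure_null_mono)
      (use convergence_exponent_finite_eventually_large in \<open>auto simp: A_def\<close>)
qed

section \<open>Continued fractions with prescribed digits\<close>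

text \<open>The convergent built from the first \<open>n\<close> entries of \<open>a\<close>.
  Recursion on the shifted sequence lets estimates go one branch at a time, without numerators and
  denominators.\<close>

fun cf_approx :: "nat \<Rightarrow> (nat \<Rightarrow> nat) \<Rightarrow> real" where
  "cf_approx 0 a = 0"
| "cf_approx (Suc n) a = cf_branch (a 0) (cf_approx n (\<lambda>i. a (Suc i)))"

definition cf_value :: "(nat \<Rightarrow> nat) \<Rightarrow> real" where
  "cf_value a = lim (\<lambda>n. cf_approx n a)"

lemma cf_approx_bounds:
  assumes "\<forall>i. 2 \<le> a i"
  shows "0 \<le> cf_approx n a \<and> cf_approx n a \<le> 1/2"
  using assms
proof (induction n arbitrary: a)
  case (Suc n)
  define y where "y = cf_approx n (\<lambda>i. a (Suc i))"
  have "0 \<le> y" unfolding y_def using Suc.IH Suc.prems by simp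
  moreover have "2 \<le> real (a 0)" using Suc.prems by simp
  ultimately show ?case by (simp add: cf_branch_def y_def[symmetric] field_simps)
qed simp

text \<open>Both convergents begin with the same \<open>n\<close> branches, and a branch with digit
  at least 2 contracts by a factor of at most 1/4.\<close>

lemma cf_approx_step:
  assumes "\<forall>i. 2 \<le> a i"
  shows "\<bar>cf_approx (Suc n) a - cf_approx n a\<bar> \<le> (1/4) ^ n"
  using assms
proof (induction n arbitrary: a)
  case 0
  with cf_approx_bounds[of a "Suc 0"] show ?case by simp
next
  case (Suc n)
  let ?b = "\<lambda>i. a (Suc i)"
  have b: "\<forall>i. 2 \<le> ?b i" using Suc.prems by blast
  have "2\<^sup>2 \<le> (real (a 0))\<^sup>2" using Suc.prems by (intro power_mono) auto
  then have a: "4 \<le> (real (a 0))\<^sup>2" by simp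
  have "\<bar>cf_approx (Suc (Suc n)) a - cf_approx (Suc n) a\<bar>
      \<le> \<bar>cf_approx (Suc n) ?b - cf_approx n ?b\<bar> / (real (a 0))\<^sup>2"
    unfolding cf_approx.simps(2)[of _ a]
    using Suc.prems[rule_format, of 0] cf_approx_bounds[OF b]
    by (intro cf_branch_diff_le) (simp_all del: cf_approx.simps)
  also have "\<dots> \<le> (1/4) ^ n / 4"
    using a by (intro frac_le Suc.IH b) auto
  finally show ?case by simp
qed

lemma cf_approx_tendsto:
  assumes "\<forall>i. 2 \<le> a i"
  shows "(\<lambda>n. cf_approx n a) \<longlonglongrightarrow> cf_value a"
proof -
  have "summable (\<lambda>n. cf_approx (Suc n) a - cf_approx n a)"
  proof (rule summable_comparison_test'[where N = 0])
    show "summable (\<lambda>n. (1/4::real) ^ n)" by (rule summable_geometric) simp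
    show "norm (cf_approx (Suc n) a - cf_approx n a) \<le> (1/4) ^ n" for n
      unfolding real_norm_def by (rule cf_approx_step[OF assms])
  qed
  then have "convergent (\<lambda>n. \<Sum>i<n. cf_approx (Suc i) a - cf_approx i a)"
    by (simp add: summable_iff_convergent)
  then have "convergent (\<lambda>n. cf_approx n a)"
    by (subst (asm) sum_lessThan_telescope) simp
  then show ?thesis by (simp add: cf_value_def convergent_LIMSEQ_iff)
qed

lemma cf_value_unfold:
  assumes "\<forall>i. 2 \<le> a i"
  shows "cf_value a = cf_branch (a 0) (cf_value (\<lambda>i. a (Suc i)))"
proof (rule LIMSEQ_unique)
  show "(\<lambda>n. cf_approx (Suc n) a) \<longlonglongrightarrow> cf_value a"
    using cf_approx_tendsto[OF assms] by (rule LIMSEQ_Suc)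
  have "0 \<le> cf_value (\<lambda>i. a (Suc i))"
    using cf_approx_bounds[of "\<lambda>i. a (Suc i)"] assms
    by (intro LIMSEQ_le_const[OF cf_approx_tendsto]) auto
  moreover have "0 < real (a 0)" using assms[rule_format, of 0] by simp
  ultimately show "(\<lambda>n. cf_approx (Suc n) a) \<longlonglongrightarrow> cf_branch (a 0) (cf_value (\<lambda>i. a (Suc i)))"
    unfolding cf_approx.simps cf_branch_def using assms
    by (intro tendsto_intros cf_approx_tendsto) auto
qed

lemma cf_value_bounds:
  assumes "\<forall>i. 2 \<le> a i"
  shows "0 < cf_value a" "cf_value a \<le> 1/2"
proof -
  have nonneg: "0 \<le> cf_value b" if "\<forall>i. 2 \<le> b i" for b
    using cf_approx_bounds[of b] that
    by (intro LIMSEQ_le_const[OF cf_approx_tendsto]) auto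
  have "0 \<le> cf_value (\<lambda>i. a (Suc i))" "2 \<le> real (a 0)"
    using assms by (auto intro!: nonneg)
  then show "0 < cf_value a" "cf_value a \<le> 1/2"
    unfolding cf_value_unfold[OF assms] cf_branch_def by (simp_all add: field_simps)
qed

lemma gauss_map_funpow_cf_value:
  assumes "\<forall>i. 2 \<le> a i"
  shows "(gauss_map ^^ n) (cf_value a) = cf_value (\<lambda>i. a (i + n))"
proof (induction n)
  case (Suc n)
  define b where "b i = a (i + n)" for i
  have b: "\<forall>i. 2 \<le> b i" using assms by (simp add: b_def)
  have v: "0 < cf_value (\<lambda>i. b (Suc i))" "cf_value (\<lambda>i. b (Suc i)) < 1"
    using cf_value_bounds[of "\<lambda>i. b (Suc i)"] b by auto
  have "gauss_map (cf_value b) = frac (real (b 0) + cf_value (\<lambda>i. b (Suc i)))"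
    using cf_value_bounds(1)[OF b] cf_value_unfold[OF b] by (simp add: gauss_map_def cf_branch_def)
  also have "\<dots> = cf_value (\<lambda>i. b (Suc i))"
    \<comment> \<open>The value of the tail lies strictly between 0 and 1, so taking the fractional
      part removes exactly the leading digit.\<close>
    using v by (simp add: frac_unique_iff)
  finally show ?case using Suc by (simp add: b_def[abs_def])
qed simp

lemma cf_index_cf_value:
  assumes "\<forall>i. 2 \<le> a i"
  shows "n \<in> cf_index (cf_value a)"
  using cf_value_bounds(1)[of "\<lambda>i. a (i + n)"] assms
  by (simp add: cf_index_def gauss_map_funpow_cf_value)

lemma cf_digit_cf_value:
  assumes "\<forall>i. 2 \<le> a i"
  shows "cf_digit (cf_value a) n = a n"
proof -
  define v where "v = cf_value (\<lambda>i. a (Suc i + n))"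
  have "0 < v" "v < 1"
    using cf_value_bounds[of "\<lambda>i. a (Suc i + n)"] assms by (auto simp: v_def)
  moreover have "cf_value (\<lambda>i. a (i + n)) = 1 / (real (a n) + v)"
    using cf_value_unfold[of "\<lambda>i. a (i + n)"] assms by (simp add: v_def cf_branch_def)
  moreover have "\<lfloor>real (a n) + v\<rfloor> = int (a n)" if "0 < v" "v < 1"
    using that by (simp add: floor_eq_iff)
  ultimately show ?thesis
    using assms by (simp add: cf_digit_def gauss_map_funpow_cf_value)
qed

text \<open>Going through a common branch shrinks the distance by a factor no smaller than 1 / (m
  i)^2. At the first disagreement the digits differ by at least 1 while both tails lie in (0, 1/2],
  which leaves a gap of at least 1/2 between the denominators.\<close>

lemma cf_value_separation:
  assumes "\<forall>i. 2 \<le> a i" "\<forall>i. 2 \<le> b i" "\<And>i. a i < m i" "\<And>i. b i < m i"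
    and "\<And>i. i < n \<Longrightarrow> a i = b i" "a n \<noteq> b n"
  shows "1 / (2 * (\<Prod>i\<le>n. (real (m i))\<^sup>2)) \<le> \<bar>cf_value a - cf_value b\<bar>"
  using assms
proof (induction n arbitrary: a b m)
  case (0 a b m)
  define u v where "u = cf_value (\<lambda>i. a (Suc i))" and "v = cf_value (\<lambda>i. b (Suc i))"
  have uv: "0 < u" "u \<le> 1/2" "0 < v" "v \<le> 1/2"
    using cf_value_bounds[of "\<lambda>i. a (Suc i)"] cf_value_bounds[of "\<lambda>i. b (Suc i)"] 0
    by (auto simp: u_def v_def)
  have ab: "real (a 0) + 1 \<le> real (m 0)" "real (b 0) + 1 \<le> real (m 0)"
    using 0(3,4)[of 0] by linarith+
  have num: "1/2 \<le> \<bar>(real (b 0) + v) - (real (a 0) + u)\<bar>"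
  proof -
    have "real (a 0) + 1 \<le> real (b 0) \<or> real (b 0) + 1 \<le> real (a 0)"
      using 0(6) by linarith
    with uv show ?thesis by linarith
  qed
  have pos: "0 < real (a 0) + u" "0 < real (b 0) + v"
    using uv by linarith+
  have "1 / (2 * (real (m 0))\<^sup>2) = (1/2) / (real (m 0) * real (m 0))"
    by (simp add: power2_eq_square)
  also have "\<dots> \<le> \<bar>(real (b 0) + v) - (real (a 0) + u)\<bar> / ((real (a 0) + u) * (real (b 0) + v))"
    using uv ab pos by (intro frac_le num mult_mono mult_pos_pos) auto
  also have "\<dots> = \<bar>((real (b 0) + v) - (real (a 0) + u)) / ((real (a 0) + u) * (real (b 0) + v))\<bar>"
    using pos by (simp add: abs_mult)
  also have "((real (b 0) + v) - (real (a 0) + u)) / ((real (a 0) + u) * (real (b 0) + v))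
      = cf_value a - cf_value b"
    using cf_value_unfold[OF 0(1)] cf_value_unfold[OF 0(2)] pos
    by (simp add: u_def[symmetric] v_def[symmetric] cf_branch_def diff_frac_eq)
  finally show ?case by simp
next
  case (Suc n a b m)
  let ?a = "\<lambda>i. a (Suc i)" and ?b = "\<lambda>i. b (Suc i)" and ?m = "\<lambda>i. m (Suc i)"
  define u v where "u = cf_value ?a" and "v = cf_value ?b"
  have uv: "0 < u" "u \<le> 1/2" "0 < v" "v \<le> 1/2"
    using cf_value_bounds[of ?a] cf_value_bounds[of ?b] Suc.prems
    by (auto simp: u_def v_def)
  have ab: "a 0 = b 0" "real (a 0) + 1 \<le> real (m 0)"
    using Suc.prems(5)[of 0] Suc.prems(3)[of 0] by simp_all
  have IH: "1 / (2 * (\<Prod>i\<le>n. (real (?m i))\<^sup>2)) \<le> \<bar>u - v\<bar>"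
    unfolding u_def v_def by (rule Suc.IH) (use Suc.prems in auto)
  have "1 / (2 * (\<Prod>i\<le>Suc n. (real (m i))\<^sup>2))
      = (1 / (2 * (\<Prod>i\<le>n. (real (?m i))\<^sup>2))) / (real (m 0) * real (m 0))"
    by (subst prod.atMost_Suc_shift) (simp add: power2_eq_square mult_ac)
  also have "\<dots> \<le> \<bar>u - v\<bar> / ((real (a 0) + u) * (real (a 0) + v))"
    using uv ab by (intro frac_le IH mult_mono mult_pos_pos) auto
  also have "\<dots> = \<bar>cf_value a - cf_value b\<bar>"
    using cf_value_unfold[OF Suc.prems(1)] cf_value_unfold[OF Suc.prems(2)] uv ab(1)
    by (simp add: u_def[symmetric] v_def[symmetric] cf_branch_diff)
  finally show ?case .
qed

section \<open>The lower bound\<close>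

text \<open>For positive bases and t in [0,1), the digit of \<open>t\<close> at the place 1 / (s 0
  ... s n) of its Cantor series expansion, given in closed form by floors.\<close>

definition mixed_radix_digit :: "(nat \<Rightarrow> nat) \<Rightarrow> real \<Rightarrow> nat \<Rightarrow> nat" where
  "mixed_radix_digit s t n = nat (\<lfloor>(\<Prod>i\<le>n. real (s i)) * t\<rfloor> mod int (s n))"

lemma mixed_radix_digit_less: "0 < s n \<Longrightarrow> mixed_radix_digit s t n < s n"
  by (simp add: mixed_radix_digit_def nat_less_iff)

lemma mixed_radix_digit_eq_imp_close:
  assumes s: "\<And>i. 0 < s i" and t: "t \<in> {0..<1}" "t' \<in> {0..<1}"
    and eq: "\<And>i. i < n \<Longrightarrow> mixed_radix_digit s t i = mixed_radix_digit s t' i"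
  shows "\<bar>t - t'\<bar> \<le> 1 / (\<Prod>i<n. real (s i))"
proof -
  define K where "K n = (\<Prod>i<n. real (s i))" for n
  have K: "0 < K n" for n using s by (auto simp: K_def intro!: prod_pos)
  \<comment> \<open>Dividing the floor at level k + 1 by \<open>s k\<close> gives the floor at level
    k with the digit as remainder. Hence equal digits below \<open>n\<close> force equal floors at
    level \<open>n\<close>.\<close>
  have div: "\<lfloor>K (Suc k) * x\<rfloor> div int (s k) = \<lfloor>K k * x\<rfloor>" for k x
    using s[of k] floor_divide_real_eq_div[of "int (s k)" "K (Suc k) * x"]
    by (simp add: K_def field_simps)
  have mod: "int (mixed_radix_digit s x k) = \<lfloor>K (Suc k) * x\<rfloor> mod int (s k)" for k x
    using s[of k] by (simp add: mixed_radix_digit_def K_def lessThan_Suc_atMost)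
  have "\<lfloor>K k * t\<rfloor> = \<lfloor>K k * t'\<rfloor>" if "k \<le> n" for k
    using that
  proof (induction k)
    case 0
    have "\<lfloor>t\<rfloor> = 0" "\<lfloor>t'\<rfloor> = 0" using t by (simp_all add: floor_eq_iff)
    then show ?case by (simp add: K_def)
  next
    case (Suc k)
    then have "\<lfloor>K (Suc k) * t\<rfloor> div int (s k) = \<lfloor>K (Suc k) * t'\<rfloor> div int (s k)"
      using div by simp
    moreover have "\<lfloor>K (Suc k) * t\<rfloor> mod int (s k) = \<lfloor>K (Suc k) * t'\<rfloor> mod int (s k)"
      using mod eq[of k] Suc.prems by (metis Suc_le_lessD)
    ultimately show ?case by (metis div_mult_mod_eq)
  qed
  then have "\<lfloor>K n * t\<rfloor> = \<lfloor>K n * t'\<rfloor>" by blast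
  then have "\<bar>K n * t - K n * t'\<bar> < 1" by linarith
  also have "\<bar>K n * t - K n * t'\<bar> = K n * \<bar>t - t'\<bar>"
    using K[of n] by (simp add: abs_mult flip: right_diff_distrib)
  finally show ?thesis using K[of n] by (simp add: K_def[symmetric] field_simps)
qed

lemma filterlim_powr_const_at_top:
  assumes "0 < c"
  shows "filterlim (\<lambda>x::real. x powr c) at_top at_top"
  unfolding filterlim_at_top
proof
  fix Z :: real
  have "Z \<le> x powr c" if "max Z 1 powr (1 / c) \<le> x" for x
  proof -
    have "Z \<le> (max Z 1 powr (1 / c)) powr c" using assms by (simp add: powr_powr)
    also have "\<dots> \<le> x powr c" using assms that by (intro powr_mono2) auto
    finally show ?thesis .
  qed
  then show "eventually (\<lambda>x. Z \<le> x powr c) at_top"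
    by (auto simp: eventually_at_top_linorder)
qed

text \<open>Bounded ratios \<open>s\<^sub>n\<^sub>+\<^sub>1 / s\<^sub>n\<close> together with \<open>s\<^sub>n \<rightarrow> \<infinity>\<close> make the quotient of both sides
  eventually increasing in \<open>n\<close>, precisely because \<open>2\<sigma> < 1\<close>.\<close>

lemma slow_growth_comparison:
  fixes s :: "nat \<Rightarrow> nat"
  assumes s: "\<And>i. 0 < s i" and ratio: "\<And>i. real (s (Suc i)) \<le> D * real (s i)"
    and lim: "filterlim (\<lambda>n. real (s n)) at_top sequentially" and \<sigma>: "0 \<le> \<sigma>" "\<sigma> < 1/2"
  obtains C where "0 < C"
    "\<And>n. 1 / (\<Prod>i<n. real (s i)) \<le> C * (1 / (2 * (\<Prod>i\<le>n. (real (2 * s i))\<^sup>2))) powr \<sigma>"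
proof -
  define P where "P n = 1 / (2 * (\<Prod>i\<le>n. (real (2 * s i))\<^sup>2))" for n
  define K where "K n = (\<Prod>i<n. real (s i))" for n
  \<comment> \<open>Up to constants this is the quotient of the two sides; the claim amounts to a
    positive lower bound for it.\<close>
  define r where "r n = K n * P n powr \<sigma>" for n
  have K: "0 < K n" for n using s by (auto simp: K_def intro!: prod_pos)
  have P: "0 < P n" for n using s by (auto simp: P_def intro!: prod_pos)
  have r: "0 < r n" for n using K[of n] P[of n] by (simp add: r_def)
  have D: "0 < D"
  proof (rule ccontr)
    assume "\<not> 0 < D"
    then have "D * real (s 0) \<le> 0" by (simp add: mult_nonpos_nonneg)
    with ratio[of 0] s[of 1] show False by simp
  qed
  have step: "r n * ((2 * D) powr (-2 * \<sigma>) * real (s n) powr (1 - 2 * \<sigma>)) \<le> r (Suc n)" for n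
  proof -
    \<comment> \<open>Passing from n to n + 1 multiplies \<open>r\<close> by s(n) * (2 s(n+1))^(-2
      \<sigma>). The ratio bound replaces s(n+1) by D * s(n), which leaves the growing factor
      s(n)^(1 - 2 \<sigma>).\<close>
    have "P (Suc n) = P n * (2 * real (s (Suc n))) powr (-2)"
      by (simp add: P_def powr_minus_divide powr_numeral)
    then have "r (Suc n) = r n * (real (s n) * (2 * real (s (Suc n))) powr (-2 * \<sigma>))"
      using P[of n] by (simp add: r_def K_def powr_mult powr_powr)
    moreover have "(2 * D * real (s n)) powr (-2 * \<sigma>) \<le> (2 * real (s (Suc n))) powr (-2 * \<sigma>)"
      using ratio[of n] s[of "Suc n"] \<sigma> by (intro powr_mono2') auto
    moreover have "(2 * D) powr (-2 * \<sigma>) * real (s n) powr (1 - 2 * \<sigma>)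
        = real (s n) * (2 * D * real (s n)) powr (-2 * \<sigma>)"
      using D s[of n] by (simp add: powr_mult powr_diff powr_minus_divide)
    ultimately show ?thesis
      using r[of n] by (simp add: mult_left_mono)
  qed
  have "filterlim (\<lambda>n. (2 * D) powr (-2 * \<sigma>) * real (s n) powr (1 - 2 * \<sigma>)) at_top sequentially"
    using D \<sigma> lim
    by (intro filterlim_tendsto_pos_mult_at_top[OF tendsto_const]
        filterlim_compose[OF filterlim_powr_const_at_top]) auto
  then have "eventually (\<lambda>n. 1 \<le> (2 * D) powr (-2 * \<sigma>) * real (s n) powr (1 - 2 * \<sigma>)) sequentially"
    by (simp add: filterlim_at_top)
  then obtain N where N: "\<And>n. N \<le> n \<Longrightarrow> 1 \<le> (2 * D) powr (-2 * \<sigma>) * real (s n) powr (1 - 2 * \<sigma>)"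
    by (auto simp: eventually_sequentially)
  have incr: "r N \<le> r n" if "N \<le> n" for n
    using that
  proof (induction n rule: dec_induct)
    case (step n)
    have "r n * 1 \<le> r n * ((2 * D) powr (-2 * \<sigma>) * real (s n) powr (1 - 2 * \<sigma>))"
      using r[of n] N[OF step(1)] by (intro mult_left_mono) auto
    also have "\<dots> \<le> r (Suc n)" by (rule \<open>\<And>n. r n * _ \<le> r (Suc n)\<close>)
    finally show ?case using step by simp
  qed simp
  \<comment> \<open>From \<open>N\<close> on \<open>r\<close> never falls below \<open>r N\<close>,
    so the minimum over the initial values is a lower bound throughout.\<close>
  define c where "c = Min (r ` {..N})"
  have c: "0 < c" using r by (auto simp: c_def)
  have "c \<le> r n" for n
  proof (cases "n \<le> N")
    case True
    then show ?thesis by (auto simp: c_def)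
  next
    case False
    have "c \<le> r N" by (auto simp: c_def)
    with incr[of n] False show ?thesis by simp
  qed
  then have "1 / K n \<le> 1 / c * P n powr \<sigma>" for n
    using c K[of n] by (simp add: r_def field_simps)
  with that[of "1 / c"] c show thesis by (simp add: K_def P_def)
qed

lemma cf_digits_window_nonzero:
  fixes s :: "nat \<Rightarrow> nat"
  assumes s: "\<And>i. 2 \<le> s i" and ratio: "\<And>i. real (s (Suc i)) \<le> D * real (s i)"
    and lim: "filterlim (\<lambda>n. real (s n)) at_top sequentially" and \<sigma>: "0 \<le> \<sigma>" "\<sigma> < 1/2"
  shows "hausdorff_measure \<sigma> (cf_value ` {a. \<forall>i. s i \<le> a i \<and> a i < 2 * s i}) \<noteq> 0"
proof -
  have s0: "0 < s i" for i using s[of i] by simp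
  \<comment> \<open>The mixed radix digits of \<open>t\<close> serve as offsets within the windows,
    so \<open>cf_value (d t)\<close> is the point that encodes \<open>t\<close>.\<close>
  define d where "d t i = s i + mixed_radix_digit s t i" for t i
  have d: "s i \<le> d t i" "d t i < 2 * s i" "2 \<le> d t i" for t i
    using mixed_radix_digit_less[of s i t, OF s0] s[of i] by (auto simp: d_def)
  obtain C where C: "0 < C"
    "\<And>n. 1 / (\<Prod>i<n. real (s i)) \<le> C * (1 / (2 * (\<Prod>i\<le>n. (real (2 * s i))\<^sup>2))) powr \<sigma>"
    using slow_growth_comparison[OF s0 ratio lim \<sigma>] by blast
  have "\<bar>t - t'\<bar> \<le> C * dist (cf_value (d t)) (cf_value (d t')) powr \<sigma>"
    if t: "t \<in> {0..<1}" "t' \<in> {0..<1}" for t t'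
  \<comment> \<open>With equal digit sequences there is no first disagreement to use. But then t =
    t', since the products of the bases are at least 2^n.\<close>
  proof (cases "d t = d t'")
    case True
    then have "mixed_radix_digit s t i = mixed_radix_digit s t' i" for i
      by (simp add: d_def fun_eq_iff)
    then have le: "\<bar>t - t'\<bar> \<le> 1 / (\<Prod>i<n. real (s i))" for n
      by (intro mixed_radix_digit_eq_imp_close s0 t)
    have "\<bar>t - t'\<bar> \<le> (1/2) ^ n" for n
    proof -
      have "(2::real) ^ n \<le> (\<Prod>i<n. real (s i))"
        using prod_mono[of "{..<n}" "\<lambda>_. 2" "\<lambda>i. real (s i)"] s by simp
      then have "1 / (\<Prod>i<n. real (s i)) \<le> 1 / 2 ^ n"
        by (intro frac_le) auto
      with le[of n] show ?thesis by (simp add: power_one_over)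
    qed
    then have "\<bar>t - t'\<bar> \<le> 0"
      by (intro LIMSEQ_le_const[OF LIMSEQ_power_zero[of "1/2::real"]]) auto
    then show ?thesis using C(1) by simp
  next
    case False
    \<comment> \<open>Agreement before \<open>n\<close> bounds the distance of t and t' from above;
      disagreement at \<open>n\<close> bounds the distance of the encoded points from below, with
      digit bounds \<open>2 * s i\<close>.\<close>
    define n where "n = (LEAST n. d t n \<noteq> d t' n)"
    obtain k where "d t k \<noteq> d t' k" using False by blast
    then have n: "d t n \<noteq> d t' n" unfolding n_def by (rule LeastI)
    have eq: "d t i = d t' i" if "i < n" for i
      using that not_less_Least unfolding n_def by blast
    then have "\<bar>t - t'\<bar> \<le> 1 / (\<Prod>i<n. real (s i))"
      by (intro mixed_radix_digit_eq_imp_close s0 t) (simp add: d_def)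
    also have "\<dots> \<le> C * (1 / (2 * (\<Prod>i\<le>n. (real (2 * s i))\<^sup>2))) powr \<sigma>" by (rule C)
    also have "\<dots> \<le> C * dist (cf_value (d t)) (cf_value (d t')) powr \<sigma>"
      unfolding dist_real_def using C(1) \<sigma> d n eq
      by (intro mult_left_mono powr_mono2 cf_value_separation) (auto intro!: prod_nonneg)
    finally show ?thesis .
  qed
  from hausdorff_measure_holder_inverse_image_nonzero[OF \<sigma>(1) C(1) this]
  have "hausdorff_measure \<sigma> ((\<lambda>t. cf_value (d t)) ` {0..<1}) \<noteq> 0" .
  moreover have "(\<lambda>t. cf_value (d t)) ` {0..<1} \<subseteq> cf_value ` {a. \<forall>i. s i \<le> a i \<and> a i < 2 * s i}"
    using d by auto
  ultimately show ?thesis using hausdorff_measure_null_mono by blast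
qed

section \<open>Digit windows with a given convergence exponent\<close>

lemma convergence_exponent_cf_value:
  assumes s: "\<And>i. 2 \<le> s i" and a: "\<And>i. s i \<le> a i" "\<And>i. a i < 2 * s i"
    and "0 \<le> \<alpha>" and conv: "\<And>p. \<alpha> < p \<Longrightarrow> summable (\<lambda>n. real (s n) powr (- p))"
    and div: "\<And>p. 0 \<le> p \<Longrightarrow> p < \<alpha> \<Longrightarrow> \<not> summable (\<lambda>n. real (s n) powr (- p))"
  shows "convergence_exponent (cf_value a) = ereal \<alpha>"
proof -
  have a2: "\<forall>i. 2 \<le> a i" using s a(1) by (meson order_trans)
  have conv_a: "summable (\<lambda>n. real (a n) powr (- p))" if "\<alpha> < p" for p
  proof (rule summable_comparison_test'[where N = 0])
    show "summable (\<lambda>n. real (s n) powr (- p))" by (rule conv[OF that])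
    have "real (a n) powr (- p) \<le> real (s n) powr (- p)" for n
      using a(1)[of n] s[of n] that assms(4) by (intro powr_mono2') auto
    then show "norm (real (a n) powr (- p)) \<le> real (s n) powr (- p)" for n by simp
  qed
  have div_a: "\<alpha> \<le> p" if "0 \<le> p" "summable (\<lambda>n. real (a n) powr (- p))" for p
  proof (rule ccontr)
    assume "\<not> \<alpha> \<le> p"
    \<comment> \<open>Since \<open>a n\<close> < \<open>2 * s n\<close>, the two series differ by at
      most a constant factor, so convergence passes back from \<open>a\<close> to
      \<open>s\<close>.\<close>
    have "real (s n) powr (- p) \<le> 2 powr p * real (a n) powr (- p)" for n
    proof -
      have "(2 * real (s n)) powr (- p) \<le> real (a n) powr (- p)"
        using a(2)[of n] a2[rule_format, of n] that(1) by (intro powr_mono2') auto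
      then have "2 powr p * (2 * real (s n)) powr (- p) \<le> 2 powr p * real (a n) powr (- p)"
        by (rule mult_left_mono) simp
      moreover have "2 powr p * (2 * real (s n)) powr (- p) = real (s n) powr (- p)"
        by (simp add: powr_mult powr_minus)
      ultimately show ?thesis by linarith
    qed
    then have "summable (\<lambda>n. real (s n) powr (- p))"
      by (intro summable_comparison_test'[OF summable_mult[OF that(2), of "2 powr p"], where N = 0]) simp
    with div[OF that(1)] \<open>\<not> \<alpha> \<le> p\<close> show False by simp
  qed
  have "convergence_exponent (cf_value a)
      = Inf {ereal p | p. 0 \<le> p \<and> summable (\<lambda>n. real (a n) powr (- p))}"
    unfolding convergence_exponent_def
    by (simp add: cf_index_cf_value[OF a2] cf_digit_cf_value[OF a2])
  also have "\<dots> = ereal \<alpha>"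
  proof (rule antisym)
    show "Inf {ereal p | p. 0 \<le> p \<and> summable (\<lambda>n. real (a n) powr (- p))} \<le> ereal \<alpha>"
    proof (rule ereal_le_epsilon2)
      fix e :: real assume "0 < e"
      then show "Inf {ereal p | p. 0 \<le> p \<and> summable (\<lambda>n. real (a n) powr (- p))} \<le> ereal \<alpha> + ereal e"
        using assms(4) conv_a[of "\<alpha> + e"] by (intro Inf_lower) auto
    qed
    show "ereal \<alpha> \<le> Inf {ereal p | p. 0 \<le> p \<and> summable (\<lambda>n. real (a n) powr (- p))}"
      using div_a by (intro Inf_greatest) auto
  qed
  finally show ?thesis .
qed

lemma convergence_exponent_window_exists:
  assumes "0 \<le> \<alpha>"
  obtains s :: "nat \<Rightarrow> nat" and D where "\<And>i. 2 \<le> s i" "\<And>i. real (s (Suc i)) \<le> D * real (s i)"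
    "filterlim (\<lambda>n. real (s n)) at_top sequentially"
    "\<And>p. \<alpha> < p \<Longrightarrow> summable (\<lambda>n. real (s n) powr (- p))"
    "\<And>p. 0 \<le> p \<Longrightarrow> p < \<alpha> \<Longrightarrow> \<not> summable (\<lambda>n. real (s n) powr (- p))"
proof (cases "\<alpha> = 0")
  case True
  \<comment> \<open>Geometric growth makes the series converge for every p > 0; the divergence
    condition is vacuous for \<alpha> = 0.\<close>
  define s :: "nat \<Rightarrow> nat" where "s n = 2 ^ Suc n" for n
  show thesis
  proof (rule that[of s 2])
    show "2 \<le> s i" for i by (simp add: s_def)
    show "real (s (Suc i)) \<le> 2 * real (s i)" for i by (simp add: s_def)
    have "n \<le> s n" for n
      using less_exp[of "Suc n"] by (simp add: s_def)
    then show "filterlim (\<lambda>n. real (s n)) at_top sequentially"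
      by (intro filterlim_at_top_mono[OF filterlim_real_sequentially]) auto
    show "summable (\<lambda>n. real (s n) powr (- p))" if "\<alpha> < p" for p
    proof -
      have "real (s n) powr (- p) = 2 powr (- p) * (2 powr (- p)) ^ n" for n
        by (simp add: s_def powr_mult powr_realpow[symmetric] powr_powr mult.commute)
      moreover have "summable (\<lambda>n. 2 powr (- p) * (2 powr (- p)) ^ n :: real)"
        using that True by (intro summable_mult summable_geometric) (simp add: powr_less_one)
      ultimately show ?thesis by simp
    qed
  qed (use True in auto)
next
  case False
  with assms have \<alpha>: "0 < \<alpha>" by simp
  \<comment> \<open>The series of the powers x(n)^(-p) is a shifted series of n^(-p / \<alpha>),
    convergent exactly for p > \<alpha>. The ratio bound 2^(1 / \<alpha>) comes from n + 3 <= 2 (n +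
    2).\<close>
  define x where "x n = (real n + 2) powr (1 / \<alpha>)" for n
  \<comment> \<open>Rounding up and adding 1 ensures s(n) >= 2 and costs at most 2, hence at most a
    factor 3, because x(n) >= 1.\<close>
  define s where "s n = nat \<lceil>x n\<rceil> + 1" for n
  have x1: "1 \<le> x n" for n using \<alpha> unfolding x_def by (intro ge_one_powr_ge_zero) auto
  have sx: "x n \<le> real (s n)" "real (s n) \<le> 3 * x n" for n
    using x1[of n] by (simp_all add: s_def) linarith+
  have pow: "x n powr (- p) = real (n + 2) powr (- p / \<alpha>)" for n p
    by (simp add: x_def powr_powr add.commute)
  have summ: "summable (\<lambda>n. x n powr (- p)) \<longleftrightarrow> \<alpha> < p" for p
  proof -
    have "summable (\<lambda>n. x n powr (- p)) \<longleftrightarrow> summable (\<lambda>n. real n powr (- p / \<alpha>))"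
      unfolding pow by (rule summable_iff_shift)
    also have "\<dots> \<longleftrightarrow> \<alpha> < p"
      using \<alpha> summable_real_powr_iff[of "- p / \<alpha>"] by (simp add: field_simps)
    finally show ?thesis .
  qed
  show thesis
  proof (rule that[of s "3 * 2 powr (1 / \<alpha>)"])
    show "2 \<le> s i" for i
      using x1[of i] by (simp add: s_def) linarith
    show "real (s (Suc i)) \<le> 3 * 2 powr (1 / \<alpha>) * real (s i)" for i
    proof -
      have "x (Suc i) \<le> (2 * (real i + 2)) powr (1 / \<alpha>)"
        unfolding x_def using \<alpha> by (intro powr_mono2) auto
      also have "\<dots> = 2 powr (1 / \<alpha>) * x i" unfolding x_def by (subst powr_mult) auto
      also have "\<dots> \<le> 2 powr (1 / \<alpha>) * real (s i)" using sx(1) by (intro mult_left_mono) auto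
      finally show ?thesis using sx(2)[of "Suc i"] by simp
    qed
    have "filterlim x at_top sequentially"
      unfolding x_def using \<alpha>
      by (intro filterlim_compose[OF filterlim_powr_const_at_top]
          filterlim_at_top_mono[OF filterlim_real_sequentially]) auto
    then show "filterlim (\<lambda>n. real (s n)) at_top sequentially"
      by (rule filterlim_at_top_mono) (use sx(1) in simp)
    show "summable (\<lambda>n. real (s n) powr (- p))" if "\<alpha> < p" for p
    proof (rule summable_comparison_test'[where N = 0])
      show "summable (\<lambda>n. x n powr (- p))" using summ that by simp
      show "norm (real (s n) powr (- p)) \<le> x n powr (- p)" for n
        using sx(1)[of n] x1[of n] that \<alpha> by (auto intro!: powr_mono2')
    qed
    show "\<not> summable (\<lambda>n. real (s n) powr (- p))" if "0 \<le> p" "p < \<alpha>" for p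
    proof
      assume *: "summable (\<lambda>n. real (s n) powr (- p))"
      have "x n powr (- p) \<le> 3 powr p * real (s n) powr (- p)" for n
      proof -
        have "(3 * x n) powr (- p) \<le> real (s n) powr (- p)"
          using sx[of n] x1[of n] that(1) by (intro powr_mono2') auto
        then have "3 powr p * (3 * x n) powr (- p) \<le> 3 powr p * real (s n) powr (- p)"
          by (rule mult_left_mono) simp
        moreover have "3 powr p * (3 * x n) powr (- p) = x n powr (- p)"
          using x1[of n] by (simp add: powr_mult powr_minus)
        ultimately show ?thesis by linarith
      qed
      then have "summable (\<lambda>n. x n powr (- p))"
        by (intro summable_comparison_test'[OF summable_mult[OF *, of "3 powr p"], where N = 0]) simp
      with summ that show False by simp
    qed
  qed
qed

section \<open>Dimensions of the level sets\<close>

lemma hausdorff_dim_convergence_exponent_finite: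
  assumes "0 \<le> \<alpha>"
  shows "hausdorff_dim {x \<in> {0..<1}. convergence_exponent x = ereal \<alpha>} = ereal (1/2)" (is "hausdorff_dim ?E = _")
proof (rule antisym)
  show "hausdorff_dim ?E \<le> ereal (1/2)"
  proof (rule hausdorff_dim_le)
    fix s :: real assume "1/2 < s"
    from convergence_exponent_finite_null[OF this] show "hausdorff_measure s ?E = 0"
      by (rule hausdorff_measure_null_mono) auto
  qed simp
  obtain s :: "nat \<Rightarrow> nat" and D where s: "\<And>i. 2 \<le> s i" "\<And>i. real (s (Suc i)) \<le> D * real (s i)"
    "filterlim (\<lambda>n. real (s n)) at_top sequentially"
    and exponent: "\<And>p. \<alpha> < p \<Longrightarrow> summable (\<lambda>n. real (s n) powr (- p))"
    "\<And>p. 0 \<le> p \<Longrightarrow> p < \<alpha> \<Longrightarrow> \<not> summable (\<lambda>n. real (s n) powr (- p))"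
    using convergence_exponent_window_exists[OF assms] by metis
  have "cf_value a \<in> ?E" if a: "\<forall>i. s i \<le> a i \<and> a i < 2 * s i" for a
  proof -
    have a2: "\<forall>i. 2 \<le> a i" using s(1) a by (meson order_trans)
    have "convergence_exponent (cf_value a) = ereal \<alpha>"
      using a by (intro convergence_exponent_cf_value[OF s(1) _ _ assms exponent]) auto
    then show ?thesis using cf_value_bounds[OF a2] by simp
  qed
  then have sub: "cf_value ` {a. \<forall>i. s i \<le> a i \<and> a i < 2 * s i} \<subseteq> ?E" by blast
  show "ereal (1/2) \<le> hausdorff_dim ?E"
  proof (rule hausdorff_dim_ge)
    fix \<sigma> :: real assume \<sigma>: "0 \<le> \<sigma>" "\<sigma> < 1/2"
    show "hausdorff_measure \<sigma> ?E \<noteq> 0"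
      using cf_digits_window_nonzero[OF s \<sigma>] hausdorff_measure_null_mono[OF _ sub] by blast
  qed
qed

lemma hausdorff_dim_convergence_exponent_infinite:
  "hausdorff_dim {x \<in> {0..<1}. convergence_exponent x = \<infinity>} = 1" (is "hausdorff_dim ?E = _")
proof (rule antisym)
  have "hausdorff_dim ?E \<le> ereal 1"
  proof (rule hausdorff_dim_le)
    fix s :: real assume "1 < s"
    from hausdorff_measure_unit_interval_null[OF this] show "hausdorff_measure s ?E = 0"
      by (rule hausdorff_measure_null_mono) auto
  qed simp
  then show "hausdorff_dim ?E \<le> 1" by (simp add: one_ereal_def)
  have "ereal 1 \<le> hausdorff_dim ?E"
  proof (rule hausdorff_dim_ge)
    fix s :: real assume s: "0 \<le> s" "s < 1"
    \<comment> \<open>The exponent is raised above 1/2 but kept below 1: then the points of finite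
      exponent form a null set while [0,1) does not. The value 3/4 is just a number between these
      bounds.\<close>
    define t where "t = max s (3/4)"
    have t: "s \<le> t" "1/2 < t" "t < 1" using s by (auto simp: t_def)
    show "hausdorff_measure s ?E \<noteq> 0"
    proof
      assume "hausdorff_measure s ?E = 0"
      then have "hausdorff_measure t ?E = 0"
        using s t hausdorff_measure_null_exponent_mono by blast
      then have "hausdorff_measure t (?E \<union> {x \<in> {0..<1}. convergence_exponent x \<noteq> \<infinity>}) = 0"
        by (intro hausdorff_measure_null_Un convergence_exponent_finite_null t)
      then have "hausdorff_measure t {0..<1::real} = 0"
        by (rule hausdorff_measure_null_mono) auto
      with hausdorff_measure_unit_interval_nonzero[of t] t show False by simp
    qed
  qed
  then show "1 \<le> hausdorff_dim ?E" by (simp add: one_ereal_def)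
qed

theorem theorem2p2:
  shows "(\<forall>\<alpha>::real. 0 \<le> \<alpha> \<longrightarrow>
            hausdorff_dim {x::real. x \<in> {0..<1} \<and> convergence_exponent x = ereal \<alpha>} = ereal (1/2))
       \<and> hausdorff_dim {x::real. x \<in> {0..<1} \<and> convergence_exponent x = \<infinity>} = 1"
  using hausdorff_dim_convergence_exponent_finite hausdorff_dim_convergence_exponent_infinite by blast

end
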